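(* ($(p,q)$-Heine transformation.) Let $0<q<p$, let $a,b,c,d,e,f$ be nonzero complex numbers, and let $z\in\mathbb{C}$ be nonzero with $|z|<1$. Assume $|acz/(pe)|<1$, $|d/c|<1$, and that $ep^k\ne fq^k$ and $pe\,p^k\neq bcz\,q^k$ for all integers $k\ge 0$. Then $${}_2\Phi_1\big((a,b),(c,d);(e,f);(p,q),z\big)=\frac{((ce,de),(pe,bcz);(p,q))_\infty}{((ce,cf),(pe,acz);(p,q))_\infty}\;{}_2\Phi_1\big((de,cf),(pe,acz);(pe,bcz);(p,q),p/(ce)\big).$$
   Context: For $n\ge 0$, $((a,b);(p,q))_n=\prod_{i=0}^{n-1}(ap^i-bq^i)$ (equal to $1$ for $n=0$), and $((a_1,b_1),\dots,(a_m,b_m);(p,q))_n=\prod_{j=1}^m((a_j,b_j);(p,q))_n$. The series ${}_2\Phi_1$ is $${}_2\Phi_1((a,b),(c,d);(e,f);(p,q),z)=\sum_{n=0}^\infty\frac{((a,b),(c,d);(p,q))_n}{((e,f);(p,q))_n\,((p,q);(p,q))_n}z^n.$$ A quotient of infinite products with the same number of pairs in numerator and denominator is understood as the limit as $N\to\infty$ of the same quotient with the subscript $\infty$ replaced by $N$. *)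

theory Defs
  imports Complex_Main
begin

definition pq_poch :: "complex \<times> complex \<Rightarrow> real \<Rightarrow> real \<Rightarrow> nat \<Rightarrow> complex" where
  "pq_poch ab p q n = (\<Prod>i<n. fst ab * of_real p ^ i - snd ab * of_real q ^ i)"

definition pq_pochs :: "(complex \<times> complex) list \<Rightarrow> real \<Rightarrow> real \<Rightarrow> nat \<Rightarrow> complex" where
  "pq_pochs prs p q n = (\<Prod>ab\<leftarrow>prs. pq_poch ab p q n)"

text \<open>Quotient of infinite products with equally many pairs in numerator and denominator:
  the limit of the finite quotients. The separate products need not converge.\<close>

definition pq_quot :: "(complex \<times> complex) list \<Rightarrow> (complex \<times> complex) list \<Rightarrow>
    real \<Rightarrow> real \<Rightarrow> nat \<Rightarrow> complex" where
  "pq_quot num den p q N = pq_pochs num p q N / pq_pochs den p q N"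

definition pq_quot_inf :: "(complex \<times> complex) list \<Rightarrow> (complex \<times> complex) list \<Rightarrow>
    real \<Rightarrow> real \<Rightarrow> complex" where
  "pq_quot_inf num den p q = lim (pq_quot num den p q)"

definition Phi21_term :: "complex \<times> complex \<Rightarrow> complex \<times> complex \<Rightarrow> complex \<times> complex \<Rightarrow>
    real \<Rightarrow> real \<Rightarrow> complex \<Rightarrow> nat \<Rightarrow> complex" where
  "Phi21_term ab cd ef p q z n =
     pq_pochs [ab, cd] p q n
       / (pq_poch ef p q n * pq_poch (of_real p, of_real q) p q n) * z ^ n"

definition Phi21 :: "complex \<times> complex \<Rightarrow> complex \<times> complex \<Rightarrow> complex \<times> complex \<Rightarrow>
    real \<Rightarrow> real \<Rightarrow> complex \<Rightarrow> complex" where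
  "Phi21 ab cd ef p q z = (\<Sum>n. Phi21_term ab cd ef p q z n)"

end

theory Submission
  imports Defs "HOL-Analysis.Infinite_Products" "HOL-Analysis.Infinite_Sum"
begin

text \<open>
  Pulling \<open>x p\<^sup>i\<close> out of each factor turns a \<open>(p,q)\<close>-product \<open>((x,y);(p,q))\<^sub>n\<close> into
  \<open>x\<^sup>n p\<^bsup>n(n-1)/2\<^esup> (y/x; r)\<^sub>n\<close>, where \<open>r = q/p\<close> and \<open>(u; r)\<^sub>n\<close> is the ordinary
  \<open>q\<close>-shifted factorial in base \<open>r\<close>. All the series and quotients in the theorem have equally many
  pairs above and below, so the powers of \<open>p\<^bsup>n(n-1)/2\<^esup>\<close> cancel, and the powers \<open>x\<^sup>n\<close> are
  absorbed into the argument of a series and cancel in the product quotient. What remains, with \<open>A = b/a\<close>, \<open>B = d/c\<close>, \<open>C = f/e\<close> and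
  \<open>Z = acz/(pe)\<close>, is Heine's classical transformation in base \<open>r\<close>, with \<open>|r| < 1\<close>
  (\<open>heine_transformation\<close>). It sends the parameters \<open>(A, B; C)\<close> and argument \<open>Z\<close> to the
  parameters \<open>(C/B, Z; AZ)\<close> and argument \<open>B\<close>.

  Heine's transformation comes from the \<open>q\<close>-binomial theorem
  \<open>\<Sum>\<^sub>n (a; r)\<^sub>n / (r; r)\<^sub>n z\<^sup>n = (az; r)\<^sub>\<infinity> / (z; r)\<^sub>\<infinity>\<close>
  used twice (\<open>q_binomial\<close>). The quotient
  \<open>(B; r)\<^sub>n / (C; r)\<^sub>n\<close> is a constant times
  \<open>(C r\<^sup>n; r)\<^sub>\<infinity> / (B r\<^sup>n; r)\<^sub>\<infinity>\<close>; expanding the latter as a binomial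
  series in \<open>B r\<^sup>n\<close> gives an absolutely convergent double series. After the order of summation is
  exchanged (\<open>suminf_swap_dominated\<close>), the sum over \<open>n\<close> is again a binomial series, now in
  \<open>Z r\<^sup>m\<close>.
\<close>

section \<open>Shifted factorials and their limits\<close>

definition qpoch :: "complex \<Rightarrow> complex \<Rightarrow> nat \<Rightarrow> complex" where
  "qpoch x r n = (\<Prod>i<n. 1 - x * r ^ i)"

definition qpoch_inf :: "complex \<Rightarrow> complex \<Rightarrow> complex" where
  "qpoch_inf x r = (\<Prod>i. 1 - x * r ^ i)"

lemma qpoch_0 [simp]: "qpoch x r 0 = 1"
  by (simp add: qpoch_def)

lemma qpoch_Suc: "qpoch x r (Suc n) = qpoch x r n * (1 - x * r ^ n)"
  by (simp add: qpoch_def)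

lemma qpoch_nonzero: "(\<And>k. x * r ^ k \<noteq> 1) \<Longrightarrow> qpoch x r n \<noteq> 0"
  by (simp add: qpoch_def)

lemma norm_mult_power_less_1:
  fixes x r :: complex
  assumes "norm x < 1" "norm r < 1"
  shows "norm (x * r ^ k) < 1"
proof -
  have "norm x * norm r ^ k \<le> norm x * 1"
    using assms by (intro mult_left_mono power_le_one) auto
  then show ?thesis using assms by (simp add: norm_mult norm_power)
qed

lemma mult_power_neq_1:
  fixes x r :: complex
  assumes "norm x < 1" "norm r < 1"
  shows "x * r ^ k \<noteq> 1"
  using norm_mult_power_less_1[OF assms, of k] by auto

lemma convergent_prod_qpoch:
  fixes x r :: complex
  assumes "norm r < 1"
  shows "convergent_prod (\<lambda>i. 1 - x * r ^ i)"
proof -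
  have "summable (\<lambda>i. norm (- x) * norm r ^ i)"
    using assms by (intro summable_mult summable_geometric) auto
  then have "summable (\<lambda>i. norm ((1 - x * r ^ i) - 1))"
    by (simp add: norm_mult norm_power)
  then show ?thesis
    using abs_convergent_prod_conv_summable abs_convergent_prod_imp_convergent_prod by blast
qed

lemma qpoch_tendsto:
  assumes "norm r < 1"
  shows "qpoch x r \<longlonglongrightarrow> qpoch_inf x r"
proof -
  have "(\<lambda>n. \<Prod>i\<le>n. 1 - x * r ^ i) \<longlonglongrightarrow> qpoch_inf x r"
    unfolding qpoch_inf_def by (rule convergent_prod_LIMSEQ[OF convergent_prod_qpoch[OF assms]])
  then have "(\<lambda>n. qpoch x r (Suc n)) \<longlonglongrightarrow> qpoch_inf x r"
    by (simp add: qpoch_def lessThan_Suc_atMost)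
  then show ?thesis by (simp only: filterlim_sequentially_Suc)
qed

lemma qpoch_inf_nonzero:
  assumes "norm r < 1" "\<And>k. x * r ^ k \<noteq> 1"
  shows "qpoch_inf x r \<noteq> 0"
  unfolding qpoch_inf_def
  by (rule prodinf_nonzero[OF convergent_prod_qpoch[OF assms(1)]]) (use assms(2) in auto)

text \<open>The limit argument, unlike division by the initial factors, also covers the case that one of
  these factors is zero.\<close>
lemma qpoch_inf_split:
  assumes "norm r < 1"
  shows "qpoch_inf x r = qpoch x r n * qpoch_inf (x * r ^ n) r"
proof -
  have eq: "qpoch x r (n + m) = qpoch x r n * qpoch (x * r ^ n) r m" for m
    by (induction m) (simp_all add: qpoch_Suc power_add mult_ac)
  have "(\<lambda>m. qpoch x r (n + m)) \<longlonglongrightarrow> qpoch_inf x r"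
    using LIMSEQ_ignore_initial_segment[OF qpoch_tendsto[OF assms], of x n]
    by (simp add: add.commute)
  moreover have "(\<lambda>m. qpoch x r (n + m)) \<longlonglongrightarrow> qpoch x r n * qpoch_inf (x * r ^ n) r"
    unfolding eq by (intro tendsto_mult_left qpoch_tendsto assms)
  ultimately show ?thesis by (rule LIMSEQ_unique)
qed

section \<open>Convergence of the basic hypergeometric series\<close>

lemma summable_norm_convergent_coeffs:
  fixes z :: complex
  assumes "convergent A" "norm z < 1"
  shows "summable (\<lambda>n. norm (A n * z ^ n))"
proof -
  from convergent_imp_Bseq[OF assms(1)] obtain K where "\<And>n. norm (A n) \<le> K"
    by (auto simp: Bseq_def)
  then have "summable (\<lambda>n. norm (A n) * norm z ^ n)"
    using assms(2) by (intro Abel_lemma[where M = K and ?r0.0 = 1]) auto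
  then show ?thesis by (simp add: norm_mult norm_power)
qed

lemma convergent_qpoch_quotient:
  assumes "norm r < 1" "\<And>k. c * r ^ k \<noteq> 1"
  shows "convergent (\<lambda>n. qpoch a r n / qpoch c r n)"
  using tendsto_divide[OF qpoch_tendsto[OF assms(1)] qpoch_tendsto[OF assms(1)]
    qpoch_inf_nonzero[OF assms]] by (rule convergentI)

text \<open>The coefficients converge, because each factor tends to an infinite product and those of the
  denominators do not vanish; this is why the radius of convergence is at least 1.\<close>
lemma convergent_phi21_coeffs:
  assumes "norm r < 1" "\<And>k. c * r ^ k \<noteq> 1"
  shows "convergent (\<lambda>n. qpoch a r n * qpoch b r n / (qpoch c r n * qpoch r r n))"
  using convergent_mult[OF convergent_qpoch_quotient[OF assms, of a]
    convergent_qpoch_quotient[OF assms(1) mult_power_neq_1[OF assms(1) assms(1)], of b]]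
  by simp

lemma summable_phi21:
  assumes "norm r < 1" "norm z < 1" "\<And>k. c * r ^ k \<noteq> 1"
  shows "summable (\<lambda>n. qpoch a r n * qpoch b r n / (qpoch c r n * qpoch r r n) * z ^ n)"
  by (rule summable_norm_cancel, rule summable_norm_convergent_coeffs)
     (intro convergent_phi21_coeffs assms)+

section \<open>The \<open>q\<close>-binomial theorem\<close>

text \<open>The recurrence for the coefficients is the functional equation
  \<open>(1 - z) F(z) = (1 - a z) F(r z)\<close> for the sum \<open>F\<close> of the series. Iterating it moves the argument to
  \<open>z r\<^sup>n\<close>, which tends to 0, where \<open>F\<close> is continuous with value 1.\<close>
theorem q_binomial:
  assumes r: "norm r < 1" and z: "norm z < 1"
  shows "(\<Sum>n. qpoch a r n / qpoch r r n * z ^ n) = qpoch_inf (a * z) r / qpoch_inf z r"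
proof -
  define A where "A n = qpoch a r n / qpoch r r n" for n
  define F where "F w = (\<Sum>n. A n * w ^ n)" for w
  have conv: "convergent A"
    unfolding A_def by (intro convergent_qpoch_quotient mult_power_neq_1 r)
  have summ: "summable (\<lambda>n. A n * w ^ n)" if "norm w < 1" for w
    by (rule summable_norm_cancel, rule summable_norm_convergent_coeffs[OF conv that])
  have rec: "A (Suc n) * (1 - r ^ Suc n) = A n * (1 - a * r ^ n)" for n
  proof -
    have "1 - r * r ^ n \<noteq> 0" "qpoch r r n \<noteq> 0"
      using mult_power_neq_1[OF r r] by (auto simp: qpoch_nonzero)
    then show ?thesis by (simp add: A_def qpoch_Suc)
  qed
  have functional: "(1 - w) * F w = (1 - a * w) * F (w * r)" if w: "norm w < 1" for w
  proof -
    have wr: "norm (w * r) < 1"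
      using norm_mult_power_less_1[OF w r, of 1] by simp
    have "(\<lambda>n. A n * w ^ n - A n * (w * r) ^ n) sums (F w - F (w * r))"
      unfolding F_def by (intro sums_diff summable_sums summ w wr)
    then have "(\<lambda>n. A (Suc n) * w ^ Suc n - A (Suc n) * (w * r) ^ Suc n) sums (F w - F (w * r))"
      using sums_Suc_iff[of "\<lambda>n. A n * w ^ n - A n * (w * r) ^ n" "F w - F (w * r)"] by simp
    moreover have "A (Suc n) * w ^ Suc n - A (Suc n) * (w * r) ^ Suc n
        = w * (A n * w ^ n) - a * w * (A n * (w * r) ^ n)" for n
    proof -
      have "A (Suc n) * w ^ Suc n - A (Suc n) * (w * r) ^ Suc n
          = A (Suc n) * (1 - r ^ Suc n) * w ^ Suc n"
        by (simp add: power_mult_distrib algebra_simps)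
      also have "\<dots> = w * (A n * w ^ n) - a * w * (A n * (w * r) ^ n)"
        unfolding rec by (simp add: power_mult_distrib algebra_simps)
      finally show ?thesis .
    qed
    ultimately have "(\<lambda>n. w * (A n * w ^ n) - a * w * (A n * (w * r) ^ n)) sums (F w - F (w * r))"
      by simp
    moreover have "(\<lambda>n. w * (A n * w ^ n) - a * w * (A n * (w * r) ^ n))
        sums (w * F w - a * w * F (w * r))"
      unfolding F_def by (intro sums_diff sums_mult summable_sums summ w wr)
    ultimately have "F w - F (w * r) = w * F w - a * w * F (w * r)"
      by (rule sums_unique2)
    then show ?thesis by (simp add: algebra_simps)
  qed
  have iter: "qpoch z r n * F z = qpoch (a * z) r n * F (z * r ^ n)" for n
  proof (induction n)
    case (Suc n)
    have zr: "norm (z * r ^ n) < 1" by (rule norm_mult_power_less_1[OF z r])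
    have "qpoch z r (Suc n) * F z = (1 - z * r ^ n) * (qpoch z r n * F z)"
      by (simp add: qpoch_Suc)
    also have "\<dots> = qpoch (a * z) r n * ((1 - z * r ^ n) * F (z * r ^ n))"
      by (simp add: Suc.IH)
    also have "\<dots> = qpoch (a * z) r (Suc n) * F (z * r ^ Suc n)"
      unfolding functional[OF zr] by (simp add: qpoch_Suc mult_ac)
    finally show ?case .
  qed simp
  have "isCont F 0"
    unfolding F_def by (rule isCont_powser[OF summ[of "1 / 2"]]) simp_all
  moreover have "(\<lambda>n. z * r ^ n) \<longlonglongrightarrow> 0"
    using tendsto_mult_right_zero[OF LIMSEQ_power_zero[OF r]] by auto
  ultimately have "(\<lambda>n. F (z * r ^ n)) \<longlonglongrightarrow> F 0"
    by (rule isCont_tendsto_compose)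
  moreover have "F 0 = 1"
    using powser_zero[of A] by (simp add: F_def A_def)
  ultimately have "(\<lambda>n. qpoch (a * z) r n * F (z * r ^ n)) \<longlonglongrightarrow> qpoch_inf (a * z) r * 1"
    by (intro tendsto_mult qpoch_tendsto r) simp
  moreover have "(\<lambda>n. qpoch z r n * F z) \<longlonglongrightarrow> qpoch_inf z r * F z"
    by (intro tendsto_mult_right qpoch_tendsto r)
  ultimately have "qpoch_inf z r * F z = qpoch_inf (a * z) r"
    unfolding iter using LIMSEQ_unique by auto
  moreover have "qpoch_inf z r \<noteq> 0"
    by (intro qpoch_inf_nonzero r mult_power_neq_1 z)
  ultimately show ?thesis
    unfolding F_def A_def by (simp add: eq_divide_eq mult.commute)
qed

section \<open>Heine's transformation\<close>

lemma suminf_swap_dominated: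
  fixes u :: "nat \<Rightarrow> nat \<Rightarrow> complex"
  assumes g: "summable g" and h: "summable h"
    and bound: "\<And>n m. norm (u n m) \<le> g n * h m"
    and g0: "\<And>n. 0 \<le> g n" and h0: "\<And>m. 0 \<le> h m"
  shows "(\<Sum>n. \<Sum>m. u n m) = (\<Sum>m. \<Sum>n. u n m)"
proof -
  have gs: "g summable_on UNIV" and hs: "(h has_sum suminf h) UNIV"
    using g h g0 h0 summable_on_UNIV_nonneg_real_iff[of g]
    by (auto intro!: norm_summable_imp_has_sum summable_sums)
  have "(\<lambda>(n, m). g n * h m) summable_on (UNIV \<times> UNIV)"
    by (rule summable_on_SigmaI[where g = "\<lambda>n. g n * suminf h"])
       (use g0 h0 in \<open>auto intro!: has_sum_cmult_right hs summable_on_cmult_left gs\<close>)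
  then have "(\<lambda>(n, m). norm (u n m)) summable_on (UNIV \<times> UNIV)"
    by (rule summable_on_comparison_test) (use bound in auto)
  then have abs: "(\<lambda>(n, m). u n m) abs_summable_on (UNIV \<times> UNIV)"
    by (simp add: case_prod_unfold)
  then have s: "(\<lambda>(n, m). u n m) summable_on (UNIV \<times> UNIV)"
    by (rule abs_summable_summable)
  have to_suminf: "infsum v UNIV = suminf v" if "v summable_on UNIV" for v :: "nat \<Rightarrow> complex"
    using has_sum_imp_sums[OF has_sum_infsum[OF that]] by (simp add: sums_iff)
  have swapped: "(\<lambda>(m, n). u n m) summable_on (UNIV \<times> UNIV)"
    using s summable_on_swap[of "\<lambda>(n, m). u n m" UNIV UNIV] by (simp add: case_prod_unfold)
  have rows: "u n summable_on UNIV" for n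
    using summable_on_SigmaD1[of u UNIV "\<lambda>_. UNIV" n] s by auto
  have cols: "(\<lambda>n. u n m) summable_on UNIV" for m
    using summable_on_SigmaD1[of "\<lambda>m n. u n m" UNIV "\<lambda>_. UNIV" m] swapped by auto
  have "(\<Sum>n. \<Sum>m. u n m) = infsum (\<lambda>n. infsum (u n) UNIV) UNIV"
    using summable_on_Sigma_banach[OF s] by (simp add: to_suminf rows)
  also have "\<dots> = infsum (\<lambda>m. infsum (\<lambda>n. u n m) UNIV) UNIV"
    by (rule infsum_swap_banach[OF s])
  also have "\<dots> = (\<Sum>m. \<Sum>n. u n m)"
    using summable_on_Sigma_banach[OF swapped] by (simp add: to_suminf cols)
  finally show ?thesis .
qed

text \<open>The double series behind both sides has terms
  \<open>u n m = A\<^sub>n z\<^sup>n C\<^sub>m b\<^sup>m r\<^bsup>nm\<^esup>\<close>; the factor \<open>r\<^bsup>nm\<^esup>\<close> is the only coupling of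
  \<open>n\<close> and \<open>m\<close>, so that either partial summation is a binomial series. As \<open>|r\<^bsup>nm\<^esup>| \<le> 1\<close>, a
  product of two convergent series dominates it.\<close>
theorem heine_transformation:
  assumes r: "norm r < 1" and z: "norm z < 1" and b: "norm b < 1" "b \<noteq> 0"
    and c: "\<And>k. c * r ^ k \<noteq> 1" and az: "\<And>k. a * z * r ^ k \<noteq> 1"
  shows "(\<Sum>n. qpoch a r n * qpoch b r n / (qpoch c r n * qpoch r r n) * z ^ n)
    = qpoch_inf b r * qpoch_inf (a * z) r / (qpoch_inf c r * qpoch_inf z r)
      * (\<Sum>n. qpoch (c / b) r n * qpoch z r n / (qpoch (a * z) r n * qpoch r r n) * b ^ n)"
proof -
  define A where "A n = qpoch a r n / qpoch r r n" for n
  define C where "C m = qpoch (c / b) r m / qpoch r r m" for m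
  define K where "K = qpoch_inf b r / qpoch_inf c r"
  define L where "L = qpoch_inf (a * z) r / qpoch_inf z r"
  define u where "u n m = (A n * z ^ n) * (C m * b ^ m) * r ^ (n * m)" for n m
  note shrink = norm_mult_power_less_1[OF _ r]
  have convA: "convergent A" and convC: "convergent C"
    unfolding A_def C_def by (intro convergent_qpoch_quotient mult_power_neq_1 r)+
  note sA = summable_norm_convergent_coeffs[OF convA z]
  note sC = summable_norm_convergent_coeffs[OF convC b(1)]
  have left: "qpoch a r n * qpoch b r n / (qpoch c r n * qpoch r r n) * z ^ n
      = K * (\<Sum>m. u n m)" for n
  proof -
    have "(\<Sum>m. C m * (b * r ^ n) ^ m)
        = qpoch_inf (c / b * (b * r ^ n)) r / qpoch_inf (b * r ^ n) r"
      unfolding C_def by (intro q_binomial r shrink b)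
    then have inner: "(\<Sum>m. C m * (b * r ^ n) ^ m)
        = qpoch_inf (c * r ^ n) r / qpoch_inf (b * r ^ n) r"
      using b(2) by simp
    have "summable (\<lambda>m. C m * (b * r ^ n) ^ m)"
      by (rule summable_norm_cancel[OF summable_norm_convergent_coeffs[OF convC shrink[OF b(1)]]])
    then have "(\<Sum>m. A n * z ^ n * (C m * (b * r ^ n) ^ m))
        = A n * z ^ n * (qpoch_inf (c * r ^ n) r / qpoch_inf (b * r ^ n) r)"
      by (simp add: suminf_mult inner)
    moreover have "A n * z ^ n * (C m * (b * r ^ n) ^ m) = u n m" for m
      by (simp add: u_def power_mult_distrib power_mult)
    ultimately have su: "(\<Sum>m. u n m)
        = A n * z ^ n * (qpoch_inf (c * r ^ n) r / qpoch_inf (b * r ^ n) r)"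
      by simp
    have nz: "qpoch_inf (b * r ^ n) r \<noteq> 0" "qpoch_inf (c * r ^ n) r \<noteq> 0" "qpoch c r n \<noteq> 0"
        "qpoch b r n \<noteq> 0"
      using qpoch_inf_nonzero[OF r c] qpoch_inf_nonzero[OF r mult_power_neq_1[OF b(1) r]]
        qpoch_inf_split[OF r, of c n] qpoch_inf_split[OF r, of b n] by auto
    show ?thesis
      unfolding su K_def A_def qpoch_inf_split[OF r, of c n] qpoch_inf_split[OF r, of b n]
      using nz by (simp add: field_simps)
  qed
  have right: "(\<Sum>n. u n m)
      = L * (qpoch (c / b) r m * qpoch z r m / (qpoch (a * z) r m * qpoch r r m) * b ^ m)" for m
  proof -
    have inner: "(\<Sum>n. A n * (z * r ^ m) ^ n) = qpoch_inf (a * z * r ^ m) r / qpoch_inf (z * r ^ m) r"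
      unfolding A_def using q_binomial[OF r shrink[OF z], of a m] by (simp add: mult.assoc)
    have "summable (\<lambda>n. A n * (z * r ^ m) ^ n)"
      by (rule summable_norm_cancel[OF summable_norm_convergent_coeffs[OF convA shrink[OF z]]])
    then have "(\<Sum>n. C m * b ^ m * (A n * (z * r ^ m) ^ n))
        = C m * b ^ m * (qpoch_inf (a * z * r ^ m) r / qpoch_inf (z * r ^ m) r)"
      by (simp add: suminf_mult inner)
    moreover have "C m * b ^ m * (A n * (z * r ^ m) ^ n) = u n m" for n
      by (simp add: u_def power_mult_distrib power_mult[symmetric] mult_ac)
    ultimately have su: "(\<Sum>n. u n m)
        = C m * b ^ m * (qpoch_inf (a * z * r ^ m) r / qpoch_inf (z * r ^ m) r)"
      by simp
    have nz: "qpoch_inf (z * r ^ m) r \<noteq> 0" "qpoch_inf (a * z * r ^ m) r \<noteq> 0" "qpoch z r m \<noteq> 0"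
        "qpoch (a * z) r m \<noteq> 0"
      using qpoch_inf_nonzero[OF r az] qpoch_inf_nonzero[OF r mult_power_neq_1[OF z r]]
        qpoch_inf_split[OF r, of z m] qpoch_inf_split[OF r, of "a * z" m] by auto
    show ?thesis
      unfolding su L_def C_def qpoch_inf_split[OF r, of z m] qpoch_inf_split[OF r, of "a * z" m]
      using nz by (simp add: field_simps)
  qed
  have swap: "(\<Sum>n. \<Sum>m. u n m) = (\<Sum>m. \<Sum>n. u n m)"
  proof (rule suminf_swap_dominated[OF sA sC])
    fix n m
    have "norm r ^ (n * m) \<le> 1" using r by (intro power_le_one) auto
    then have "norm (A n * z ^ n) * norm (C m * b ^ m) * norm r ^ (n * m)
        \<le> norm (A n * z ^ n) * norm (C m * b ^ m) * 1"
      by (intro mult_left_mono) auto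
    then show "norm (u n m) \<le> norm (A n * z ^ n) * norm (C m * b ^ m)"
      by (simp add: u_def norm_mult norm_power)
  qed auto
  \<comment> \<open>Dividing the left-hand series by \<open>K\<close> yields summability of the row sums, which pulling
    \<open>K\<close> out of the infinite sum requires.\<close>
  have K0: "K \<noteq> 0"
    using qpoch_inf_nonzero[OF r c] qpoch_inf_nonzero[OF r mult_power_neq_1[OF b(1) r]]
    by (simp add: K_def)
  have "summable (\<lambda>n. K * (\<Sum>m. u n m))"
    unfolding left[symmetric] by (intro summable_phi21 r z c)
  then have "summable (\<lambda>n. \<Sum>m. u n m)"
    using K0 by (simp add: summable_cmult_iff)
  then have "(\<Sum>n. K * (\<Sum>m. u n m)) = K * (\<Sum>m. \<Sum>n. u n m)"
    by (simp add: suminf_mult swap)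
  also have "\<dots> = K * (L *
      (\<Sum>n. qpoch (c / b) r n * qpoch z r n / (qpoch (a * z) r n * qpoch r r n) * b ^ n))"
    unfolding right by (subst suminf_mult) (intro summable_phi21 r b az refl)+
  finally show ?thesis
    unfolding left by (simp add: K_def L_def)
qed

section \<open>Reduction of the \<open>(p,q)\<close>-series to base \<open>q/p\<close>\<close>

lemma pq_poch_eq_qpoch:
  assumes "x \<noteq> 0" "p \<noteq> 0"
  shows "pq_poch (x, y) p q n
    = x ^ n * (\<Prod>i<n. of_real p ^ i) * qpoch (y / x) (of_real (q / p)) n"
proof -
  have "x * of_real p ^ i - y * of_real q ^ i
      = x * (of_real p ^ i * (1 - y / x * of_real (q / p) ^ i))" for i
    using assms by (simp add: power_divide right_diff_distrib)
  then have "pq_poch (x, y) p q n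
      = (\<Prod>i<n. x * (of_real p ^ i * (1 - y / x * of_real (q / p) ^ i)))"
    unfolding pq_poch_def fst_conv snd_conv by (simp only:)
  then show ?thesis
    by (simp only: prod.distrib qpoch_def prod_constant card_lessThan mult.assoc)
qed

lemma Phi21_term_eq:
  assumes "p \<noteq> 0" "a \<noteq> 0" "c \<noteq> 0" "e \<noteq> 0"
  shows "Phi21_term (a, b) (c, d) (e, f) p q z n =
    (let r = of_real (q / p) in
      qpoch (b / a) r n * qpoch (d / c) r n / (qpoch (f / e) r n * qpoch r r n)
        * (a * c * z / (of_real p * e)) ^ n)"
proof -
  have "(\<Prod>i<n. complex_of_real p ^ i) \<noteq> 0" using assms by simp
  then show ?thesis
    using assms
    by (simp add: Phi21_term_def pq_pochs_def pq_poch_eq_qpoch Let_def power_mult_distrib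
        power_divide mult_ac)
qed

text \<open>Since numerator and denominator share the first entries \<open>x\<close> and \<open>y\<close>, the powers
  \<open>x\<^sup>n y\<^sup>n\<close> cancel; this is what makes the quotient converge even where the
  separate products do not.\<close>
lemma pq_quot_eq:
  assumes "p \<noteq> 0" "x \<noteq> 0" "y \<noteq> 0"
  shows "pq_quot [(x, b), (y, d)] [(x, f), (y, g)] p q n =
    (let r = of_real (q / p) in
      qpoch (b / x) r n * qpoch (d / y) r n / (qpoch (f / x) r n * qpoch (g / y) r n))"
proof -
  have "(\<Prod>i<n. complex_of_real p ^ i) \<noteq> 0" using assms by simp
  then show ?thesis
    using assms by (simp add: pq_quot_def pq_pochs_def pq_poch_eq_qpoch Let_def)
qed

theorem mainTheorem3:
  fixes p q :: real and a b c d e f z :: complex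
  assumes "0 < q" and "q < p"
    and "a \<noteq> 0" and "b \<noteq> 0" and "c \<noteq> 0" and "d \<noteq> 0" and "e \<noteq> 0" and "f \<noteq> 0"
    and "z \<noteq> 0" and "norm z < 1"
    and "norm (a * c * z / (of_real p * e)) < 1"
    and "norm (d / c) < 1"
    and "\<And>k::nat. e * of_real p ^ k \<noteq> f * of_real q ^ k"
    and "\<And>k::nat. of_real p * e * of_real p ^ k \<noteq> b * c * z * of_real q ^ k"
  shows "summable (Phi21_term (a, b) (c, d) (e, f) p q z)
    \<and> summable (Phi21_term (d * e, c * f) (of_real p * e, a * c * z) (of_real p * e, b * c * z)
                  p q (of_real p / (c * e)))
    \<and> convergent (pq_quot [(c * e, d * e), (of_real p * e, b * c * z)]
                          [(c * e, c * f), (of_real p * e, a * c * z)] p q)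
    \<and> Phi21 (a, b) (c, d) (e, f) p q z =
        pq_quot_inf [(c * e, d * e), (of_real p * e, b * c * z)]
                    [(c * e, c * f), (of_real p * e, a * c * z)] p q
        * Phi21 (d * e, c * f) (of_real p * e, a * c * z) (of_real p * e, b * c * z)
            p q (of_real p / (c * e))"
proof -
  define r where "r = complex_of_real (q / p)"
  define Z where "Z = a * c * z / (of_real p * e)"
  define A where "A = b / a"
  define B where "B = d / c"
  define C where "C = f / e"
  have p: "p \<noteq> 0" and Z: "norm Z < 1" and B: "norm B < 1" "B \<noteq> 0"
    using assms by (auto simp: Z_def B_def)
  have r: "norm r < 1"
    unfolding r_def norm_of_real using assms(1,2) by simp
  have AZ: "A * Z = b * c * z / (of_real p * e)"
    using assms by (simp add: A_def Z_def)
  have C': "C * r ^ k \<noteq> 1" for k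
    using assms(13)[of k] assms(7) p by (simp add: C_def r_def power_divide field_simps)
  have AZ': "A * Z * r ^ k \<noteq> 1" for k
    using assms(14)[of k] assms(7) p unfolding AZ by (simp add: r_def power_divide field_simps)
  have params: "c * f / (d * e) = C / B"
    "d * e * (of_real p * e) * (of_real p / (c * e)) / (of_real p * (of_real p * e)) = B"
    "d * e / (c * e) = B" "c * f / (c * e) = C"
    using assms p by (simp_all add: B_def C_def mult.commute)
  have lhs: "Phi21_term (a, b) (c, d) (e, f) p q z
      = (\<lambda>n. qpoch A r n * qpoch B r n / (qpoch C r n * qpoch r r n) * Z ^ n)"
    using assms p by (simp add: fun_eq_iff Phi21_term_eq Let_def A_def B_def C_def Z_def r_def)
  have rhs: "Phi21_term (d * e, c * f) (of_real p * e, a * c * z) (of_real p * e, b * c * z)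
        p q (of_real p / (c * e))
      = (\<lambda>n. qpoch (C / B) r n * qpoch Z r n / (qpoch (A * Z) r n * qpoch r r n) * B ^ n)"
    using assms p unfolding fun_eq_iff
    by (subst Phi21_term_eq) (simp_all only: params AZ Let_def Z_def[symmetric] r_def[symmetric]
        simp_thms mult_eq_0_iff of_real_eq_0_iff)
  have quot: "pq_quot [(c * e, d * e), (of_real p * e, b * c * z)]
        [(c * e, c * f), (of_real p * e, a * c * z)] p q
      = (\<lambda>n. qpoch B r n * qpoch (A * Z) r n / (qpoch C r n * qpoch Z r n))"
    using assms p unfolding fun_eq_iff
    by (subst pq_quot_eq) (simp_all only: params AZ Let_def Z_def[symmetric] r_def[symmetric]
        simp_thms mult_eq_0_iff of_real_eq_0_iff)
  have lim: "pq_quot [(c * e, d * e), (of_real p * e, b * c * z)]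
        [(c * e, c * f), (of_real p * e, a * c * z)] p q
      \<longlonglongrightarrow> qpoch_inf B r * qpoch_inf (A * Z) r / (qpoch_inf C r * qpoch_inf Z r)"
    unfolding quot
    using qpoch_inf_nonzero[OF r C'] qpoch_inf_nonzero[OF r mult_power_neq_1[OF Z r]]
    by (intro tendsto_divide tendsto_mult qpoch_tendsto r) auto
  have "Phi21 (a, b) (c, d) (e, f) p q z =
        pq_quot_inf [(c * e, d * e), (of_real p * e, b * c * z)]
                    [(c * e, c * f), (of_real p * e, a * c * z)] p q
        * Phi21 (d * e, c * f) (of_real p * e, a * c * z) (of_real p * e, b * c * z)
            p q (of_real p / (c * e))"
    unfolding Phi21_def pq_quot_inf_def limI[OF lim] lhs rhs
    by (intro heine_transformation r Z B C' AZ')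
  moreover have "summable (Phi21_term (a, b) (c, d) (e, f) p q z)"
    unfolding lhs by (intro summable_phi21 r Z C')
  moreover have "summable (Phi21_term (d * e, c * f) (of_real p * e, a * c * z)
      (of_real p * e, b * c * z) p q (of_real p / (c * e)))"
    unfolding rhs by (intro summable_phi21 r B AZ')
  ultimately show ?thesis using convergentI[OF lim] by blast
qed

end
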